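(* Assume that $\mathfrak{d}\leq\mathfrak{r}$. Then: (1) There is a Menger set of reals that is not Scheepers. (2) The Menger property is not productive; that is, there are two Menger sets of reals whose product space is not Menger.
   Context: A set of reals is a topological space homeomorphic to a subspace of the real line with the standard topology. A space $X$ is Menger if for each sequence $\mathcal{U}_1,\mathcal{U}_2,\dotsc$ of open covers of $X$ there are finite sets $\mathcal{F}_1\subseteq\mathcal{U}_1,\mathcal{F}_2\subseteq\mathcal{U}_2,\dotsc$ such that the family $\bigcup_{n}\mathcal{F}_n$ covers $X$. A space $X$ is Scheepers if for each such sequence there are finite sets $\mathcal{F}_n\subseteq\mathcal{U}_n$ such that each finite subset of $X$ is contained in $\bigcup\mathcal{F}_n$ for some $n$. $\mathbb{N}$ is the set of positive natural numbers and $[\mathbb{N}]^\infty$ is the set of infinite subsets of $\mathbb{N}$. Each $a\in[\mathbb{N}]^\infty$ is identified with its increasing enumeration, so $a(n)$ is the $n$-th smallest element of $a$. For $x,y\in[\mathbb{N}]^\infty$, $x\leq^* y$ means that $\{n: y(n)<x(n)\}$ is finite. A subset $D$ of $[\mathbb{N}]^\infty$ is dominating if for each $x\in[\mathbb{N}]^\infty$ there is $y\in D$ with $x\leq^* y$; $\mathfrak{d}$ is the minimal cardinality of a dominating subset of $[\mathbb{N}]^\infty$. A set $r\in[\mathbb{N}]^\infty$ reaps a family $A\subseteq[\mathbb{N}]^\infty$ if for each $a\in A$ both $a\cap r$ and $a\setminus r$ are infinite; $\mathfrak{r}$ is the minimal cardinality of a family $A\subseteq[\mathbb{N}]^\infty$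 that no set $r\in[\mathbb{N}]^\infty$ reaps. *)

theory Defs
  imports "HOL-Analysis.Analysis" "HOL-Library.Infinite_Set"
begin

unbundle cardinal_syntax

definition set_of_reals :: "'a topology \<Rightarrow> bool" where
  "set_of_reals X \<longleftrightarrow> (\<exists>S :: real set. X homeomorphic_space top_of_set S)"

definition open_cover :: "'a topology \<Rightarrow> 'a set set \<Rightarrow> bool" where
  "open_cover X \<U> \<longleftrightarrow> (\<forall>U\<in>\<U>. openin X U) \<and> \<Union>\<U> = topspace X"

definition Menger_space :: "'a topology \<Rightarrow> bool" where
  "Menger_space X \<longleftrightarrow>
    (\<forall>\<U> :: nat \<Rightarrow> 'a set set. (\<forall>n. open_cover X (\<U> n)) \<longrightarrow>
      (\<exists>\<F>. (\<forall>n. finite (\<F> n) \<and> \<F> n \<subseteq> \<U> n) \<and> topspace X \<subseteq> \<Union>(\<Union>n. \<F> n)))"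

definition Scheepers_space :: "'a topology \<Rightarrow> bool" where
  "Scheepers_space X \<longleftrightarrow>
    (\<forall>\<U> :: nat \<Rightarrow> 'a set set. (\<forall>n. open_cover X (\<U> n)) \<longrightarrow>
      (\<exists>\<F>. (\<forall>n. finite (\<F> n) \<and> \<F> n \<subseteq> \<U> n) \<and>
           (\<forall>K. finite K \<and> K \<subseteq> topspace X \<longrightarrow> (\<exists>n. K \<subseteq> \<Union>(\<F> n)))))"

definition inf_sets :: "nat set set" where
  "inf_sets = {a. a \<subseteq> {1..} \<and> infinite a}"

text \<open>
  The library function \<open>enumerate\<close> starts at index \<open>0\<close>; here the smallest element of a set has
  index \<open>1\<close>, and \<open>nth_smallest\<close> is only used for positive indices.
\<close>

definition nth_smallest :: "nat set \<Rightarrow> nat \<Rightarrow> nat" where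
  "nth_smallest a n = enumerate a (n - 1)"

definition le_star :: "nat set \<Rightarrow> nat set \<Rightarrow> bool" (infix "\<le>*" 50) where
  "x \<le>* y \<longleftrightarrow> finite {n. n \<ge> 1 \<and> nth_smallest y n < nth_smallest x n}"

definition dominating :: "nat set set \<Rightarrow> bool" where
  "dominating D \<longleftrightarrow> D \<subseteq> inf_sets \<and> (\<forall>x\<in>inf_sets. \<exists>y\<in>D. x \<le>* y)"

definition reaps :: "nat set \<Rightarrow> nat set set \<Rightarrow> bool" where
  "reaps r A \<longleftrightarrow> r \<in> inf_sets \<and> (\<forall>a\<in>A. infinite (a \<inter> r) \<and> infinite (a - r))"

definition unreaped :: "nat set set \<Rightarrow> bool" where
  "unreaped A \<longleftrightarrow> A \<subseteq> inf_sets \<and> (\<forall>r\<in>inf_sets. \<not> reaps r A)"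

text \<open>
  Cardinals are represented by the relations \<open>|A|\<close>, compared by \<open>\<le>o\<close>. Different sets \<open>A\<close> of the
  same size give equivalent (\<open>=o\<close>) but not equal relations, so that the minimal cardinality is
  unique only up to \<open>=o\<close>, and \<open>SOME\<close> picks a representative.
\<close>

definition min_cardinality :: "('a set \<Rightarrow> bool) \<Rightarrow> 'a rel" where
  "min_cardinality P = |SOME A. P A \<and> (\<forall>B. P B \<longrightarrow> |A| \<le>o |B| )|"

definition cardinal_d :: "nat set rel" where
  "cardinal_d = min_cardinality dominating"

definition cardinal_r :: "nat set rel" where
  "cardinal_r = min_cardinality unreaped"

lemma min_cardinality:
  assumes "P A0"
  shows "\<exists>A. P A \<and> min_cardinality P = |A|" and "P B \<Longrightarrow> min_cardinality P \<le>o |B|"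
proof -
  have "\<exists>r \<in> card_of ` Collect P. \<forall>r' \<in> card_of ` Collect P. r \<le>o r'"
    by (rule exists_minim_Well_order) (use assms card_of_Well_order in auto)
  then have "\<exists>A. P A \<and> (\<forall>B. P B \<longrightarrow> |A| \<le>o |B| )"
    by auto
  from someI_ex[OF this]
  show "\<exists>A. P A \<and> min_cardinality P = |A|" and "P B \<Longrightarrow> min_cardinality P \<le>o |B|"
    unfolding min_cardinality_def by blast+
qed

lemma dominating_inf_sets: "dominating inf_sets"
  unfolding dominating_def le_star_def by (auto intro!: bexI)

lemma unreaped_inf_sets: "unreaped inf_sets"
  unfolding unreaped_def reaps_def by (metis Diff_cancel finite.emptyI order_refl)

lemmas cardinal_d = min_cardinality[of dominating, OF dominating_inf_sets, folded cardinal_d_def]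
lemmas cardinal_r = min_cardinality[of unreaped, OF unreaped_inf_sets, folded cardinal_r_def]

end

theory Submission
  imports Defs
begin

text \<open>
  List a family of \<open>\<dd>\<close> functions dominating everywhere in a well-order of minimal type. At a stage \<open>h\<close>
  fewer than \<open>\<dd>\<close> functions \<open>f\<close> precede, so some interval partition has, for each of them, infinitely
  many parts containing an interval \<open>[m, f m)\<close>; it may be chosen to grow faster than \<open>h\<close>. Since
  \<open>\<dd> \<le> \<rr>\<close>, some \<open>r\<close> reaps the corresponding sets of indices, and the union \<open>x\<close> of the parts with
  index in \<open>r\<close>, as well as its complement, contains \<open>[m, f m)\<close> for infinitely many \<open>m\<close>.

  Collect such \<open>x\<close> and \<open>- x\<close> from all stages. An open set containing the finite sets contains every
  \<open>x\<close> missing some \<open>[m, f m)\<close>, where \<open>f\<close> depends only on the open set, hence all but fewer than \<open>\<dd>\<close>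
  members: so the family together with the finite sets is Menger. On the other hand, pairing adjacent
  parts in the two possible ways, one of four sets of stage \<open>h\<close> contains \<open>[n, h n]\<close>, whatever \<open>n\<close> is,
  which refutes the Scheepers property. For the square, cover the pairs \<open>(a, b)\<close> by the sets stating
  that two consecutive intervals \<open>[n, m]\<close> and \<open>[m, k]\<close> lie in neither \<open>a\<close> nor \<open>b\<close>; for the pair
  \<open>(x, - x)\<close> of stage \<open>h\<close> this requires \<open>h n < k\<close>, so no choice of one \<open>k\<close> for each \<open>n\<close> suffices.
\<close>

section \<open>Dominating and reaping families\<close>

text \<open>Indices counted from 1 become those of \<open>enumerate\<close>, counted from 0, so the
  exceptional set is merely shifted by \<open>Suc\<close>.\<close>

lemma le_star_iff: "x \<le>* y \<longleftrightarrow> finite {n. enumerate y n < enumerate x n}"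
proof -
  have "{n. n \<ge> 1 \<and> nth_smallest y n < nth_smallest x n} = Suc ` {n. enumerate y n < enumerate x n}"
  proof (intro set_eqI iffI)
    fix n assume "n \<in> {n. n \<ge> 1 \<and> nth_smallest y n < nth_smallest x n}"
    then show "n \<in> Suc ` {n. enumerate y n < enumerate x n}"
      by (cases n) (auto simp: nth_smallest_def)
  qed (auto simp: nth_smallest_def)
  then show ?thesis
    by (simp add: le_star_def finite_image_iff)
qed

lemma enumerate_range_ge:
  fixes u :: "nat \<Rightarrow> nat"
  assumes "strict_mono u"
  shows "u n \<le> enumerate (range u) n"
proof (induction n)
  have inf: "infinite (range u)"
    using assms by (simp add: finite_image_iff strict_mono_imp_inj_on)
  case 0
  obtain m where "enumerate (range u) 0 = u m"
    using enumerate_in_set[OF inf, of 0] by auto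
  then show ?case
    by (simp add: assms strict_mono_less_eq)
next
  have inf: "infinite (range u)"
    using assms by (simp add: finite_image_iff strict_mono_imp_inj_on)
  case (Suc n)
  obtain m where m: "enumerate (range u) (Suc n) = u m"
    using enumerate_in_set[OF inf, of "Suc n"] by auto
  then have "u n < u m"
    using Suc enumerate_step[OF inf, of n] by simp
  then have "Suc n \<le> m"
    by (simp add: assms strict_mono_less)
  then show ?case
    using m by (simp add: assms strict_mono_less_eq)
qed

lemma strict_mono_majorant:
  fixes f :: "nat \<Rightarrow> nat"
  obtains u where "strict_mono u" "\<And>n. f n < u n" "\<And>n. n < u n"
proof
  \<comment> \<open>Partial sums: every summand is at least 1, which gives strict growth and the
    bound by \<open>n\<close>; the last summand gives the bound by \<open>f n\<close>.\<close>
  let ?u = "\<lambda>n. \<Sum>i\<le>n. Suc (f i)"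
  show "strict_mono ?u"
    by (simp add: strict_mono_Suc_iff)
  show "f n < ?u n" for n
    using member_le_sum[of n "{..n}" "\<lambda>i. Suc (f i)"] by simp
  show "n < ?u n" for n
    using sum_mono[of "{..n}" "\<lambda>_. 1" "\<lambda>i. Suc (f i)"] by simp
qed

lemma ex_inf_set_enumerate_ge:
  fixes f :: "nat \<Rightarrow> nat"
  shows "\<exists>s\<in>inf_sets. \<forall>n. f n \<le> enumerate s n"
proof -
  obtain u where u: "strict_mono u" "\<And>n. f n < u n" "\<And>n. n < u n"
    using strict_mono_majorant[of f] by blast
  have "range u \<in> inf_sets"
  proof -
    have "infinite (range u)"
      using u(1) by (simp add: finite_image_iff strict_mono_imp_inj_on)
    \<comment> \<open>The bound \<open>n < u n\<close> keeps 0 out of the range, as membership in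
      \<open>inf_sets\<close> requires.\<close>
    moreover have "1 \<le> u n" for n
      using u(3)[of n] by simp
    ultimately show ?thesis
      by (auto simp: inf_sets_def)
  qed
  moreover have "f n \<le> enumerate (range u) n" for n
    using enumerate_range_ge[OF u(1), of n] u(2)[of n] by simp
  ultimately show ?thesis
    by blast
qed

text \<open>Replace each \<open>\<phi> f\<close> by the enumeration of an infinite set above it.
  Fewer than \<open>cardinal_d\<close> such sets are not dominating, so some \<open>x\<close> lies
  below none of them, and its enumeration serves as \<open>g\<close>.\<close>

lemma small_family_not_dominating:
  fixes F :: "'i set" and \<phi> :: "'i \<Rightarrow> nat \<Rightarrow> nat"
  assumes "|F| <o cardinal_d"
  obtains g where "\<And>f. f \<in> F \<Longrightarrow> infinite {n. \<phi> f n < g n}"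
proof -
  have "\<forall>f. \<exists>s\<in>inf_sets. \<forall>n. \<phi> f n \<le> enumerate s n"
    using ex_inf_set_enumerate_ge by blast
  then obtain s where s: "\<And>f. s f \<in> inf_sets" "\<And>f n. \<phi> f n \<le> enumerate (s f) n"
    by metis
  have "\<not> cardinal_d \<le>o |s ` F|"
    using assms ordLeq_ordLess_trans[OF card_of_image] not_ordLess_ordLeq by blast
  then have "\<not> dominating (s ` F)"
    using cardinal_d(2) by blast
  then obtain x where x: "x \<in> inf_sets" "\<And>f. f \<in> F \<Longrightarrow> \<not> x \<le>* s f"
    using s(1) by (auto simp: dominating_def)
  have "infinite {n. \<phi> f n < enumerate x n}" if "f \<in> F" for f
  proof -
    have "{n. enumerate (s f) n < enumerate x n} \<subseteq> {n. \<phi> f n < enumerate x n}"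
      using s(2) by (auto intro: le_less_trans)
    then show ?thesis
      using x(2)[OF that] finite_subset by (auto simp: le_star_iff)
  qed
  then show ?thesis
    using that by blast
qed

text \<open>A dominating family of least size bounds every function with finitely many exceptions.
  Adding all constants to its enumerations absorbs the exceptions, and countably many copies of an
  infinite family do not enlarge it.\<close>

lemma everywhere_dominating_family:
  obtains D :: "(nat \<Rightarrow> nat) set"
  where "\<And>f. \<exists>h\<in>D. \<forall>n. f n \<le> h n" and "\<And>h. h \<in> D \<Longrightarrow> mono h"
    and "\<And>h n. h \<in> D \<Longrightarrow> n < h n"
    and "|D| \<le>o cardinal_d" and "infinite D"
proof -
  obtain A where A: "dominating A" "cardinal_d = |A|"
    using cardinal_d(1) by blast
  \<comment> \<open>The successor turns \<open>n \<le> enumerate y n\<close> into the strict bound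
    \<open>n < h n\<close>.\<close>
  define D where "D = (\<lambda>(y, k) n. Suc (enumerate y n + k)) ` (A \<times> (UNIV :: nat set))"
  have dom: "\<exists>y\<in>A. \<exists>k. \<forall>n. f n \<le> enumerate y n + k" for f :: "nat \<Rightarrow> nat"
  proof -
    obtain s where s: "s \<in> inf_sets" "\<And>n. f n \<le> enumerate s n"
      using ex_inf_set_enumerate_ge by blast
    then obtain y where y: "y \<in> A" "finite {n. enumerate y n < enumerate s n}"
      using A(1) by (auto simp: dominating_def le_star_iff)
    \<comment> \<open>The constant sums the values of \<open>s\<close> at the finitely many indices
      where \<open>y\<close> falls below \<open>s\<close>.\<close>
    have "f n \<le> enumerate y n + (\<Sum>i\<in>{n. enumerate y n < enumerate s n}. enumerate s i)" for n
    proof (cases "enumerate y n < enumerate s n")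
      case True
      then have "enumerate s n \<le> (\<Sum>i\<in>{n. enumerate y n < enumerate s n}. enumerate s i)"
        using y(2) by (intro member_le_sum) auto
      then show ?thesis
        using s(2)[of n] by linarith
    next
      case False
      then show ?thesis
        using s(2)[of n] by linarith
    qed
    then show ?thesis
      using y(1) by blast
  qed
  have D_dom: "\<exists>h\<in>D. \<forall>n. f n \<le> h n" for f
    using dom[of f] unfolding D_def by (fastforce intro: le_SucI)
  have infA: "infinite A"
  proof
    assume fin: "finite A"
    \<comment> \<open>The summand \<open>n\<close> outgrows every constant, so a finite
      \<open>A\<close> fails at the index \<open>Suc k\<close>.\<close>
    obtain y k where y: "y \<in> A" "\<And>n. n + (\<Sum>z\<in>A. enumerate z n) \<le> enumerate y n + k"
      using dom[of "\<lambda>n. n + (\<Sum>z\<in>A. enumerate z n)"] by blast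
    have "enumerate y (Suc k) \<le> (\<Sum>z\<in>A. enumerate z (Suc k))"
      using y(1) fin by (intro member_le_sum) auto
    then show False
      using y(2)[of "Suc k"] by linarith
  qed
  have D_inf: "infinite D"
  proof
    assume fin: "finite D"
    obtain h where h: "h \<in> D" "\<And>n. Suc (\<Sum>z\<in>D. z n) \<le> h n"
      using D_dom[of "\<lambda>n. Suc (\<Sum>z\<in>D. z n)"] by blast
    have "h 0 \<le> (\<Sum>z\<in>D. z 0)"
      using h(1) fin by (intro member_le_sum) auto
    then show False
      using h(2)[of 0] by linarith
  qed
  have D_mono: "mono h" if "h \<in> D" for h
    using that A(1) by (auto simp: D_def dominating_def inf_sets_def mono_def subset_iff)
  have D_gt: "n < h n" if "h \<in> D" for h n
    using that A(1)
    by (force simp: D_def dominating_def inf_sets_def less_Suc_eq_le intro: trans_le_add1 le_enumerate)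
  have D_card: "|D| \<le>o cardinal_d"
  proof -
    have "|A \<times> (UNIV :: nat set)| =o |A|"
      using infA by (simp add: card_of_Times_infinite_simps infinite_iff_card_of_nat)
    then show ?thesis
      unfolding D_def A(2) using card_of_image ordLeq_ordIso_trans by blast
  qed
  show ?thesis
    using D_dom D_mono D_gt D_card D_inf by (rule that[of D])
qed

text \<open>The sets \<open>A f\<close> may contain 0, while \<open>inf_sets\<close> consists of
  sets of positive numbers; so the images under \<open>Suc\<close> are reaped and the reaping set is
  pulled back.\<close>

lemma small_family_reaped:
  fixes F :: "'i set" and A :: "'i \<Rightarrow> nat set"
  assumes "|F| <o cardinal_r" and inf: "\<And>f. f \<in> F \<Longrightarrow> infinite (A f)"
  obtains r where "\<And>f. f \<in> F \<Longrightarrow> infinite (A f \<inter> r)" "\<And>f. f \<in> F \<Longrightarrow> infinite (A f - r)"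
proof -
  let ?B = "(\<lambda>f. Suc ` A f) ` F"
  have "\<not> cardinal_r \<le>o |?B|"
    using assms ordLeq_ordLess_trans[OF card_of_image] not_ordLess_ordLeq by blast
  then have "\<not> unreaped ?B"
    using cardinal_r(2) by blast
  moreover have "?B \<subseteq> inf_sets"
    using inf by (auto simp: inf_sets_def finite_image_iff)
  ultimately obtain r where r: "\<And>f. f \<in> F \<Longrightarrow> infinite (Suc ` A f \<inter> r) \<and> infinite (Suc ` A f - r)"
    by (auto simp: unreaped_def reaps_def)
  have "Suc ` A f \<inter> r = Suc ` (A f \<inter> Suc -` r)" "Suc ` A f - r = Suc ` (A f - Suc -` r)" for f
    by auto
  then show ?thesis
    using r that[of "Suc -` r"] by (simp add: finite_image_iff)
qed

lemma finite_set_ordLess_infinite_set: "finite A \<Longrightarrow> infinite B \<Longrightarrow> |A| <o |B|"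
  by (rule finite_ordLess_infinite) (simp_all add: card_of_well_order_on Field_card_of)

text \<open>Over an infinite \<open>I\<close>, a union of finite sets is no larger than
  \<open>I\<close>; over a finite \<open>I\<close> it is finite. So the bound holds even if
  \<open>|D|\<close> is singular.\<close>

lemma card_of_UN_finite_ordLess:
  assumes "infinite D" "|I| <o |D|" "\<And>i. i \<in> I \<Longrightarrow> finite (A i)"
  shows "|\<Union>i\<in>I. A i| <o |D|"
proof (cases "finite I")
  case True
  then have "finite (\<Union>i\<in>I. A i)"
    using assms(3) by blast
  then show ?thesis
    using assms(1) by (simp add: finite_set_ordLess_infinite_set)
next
  case False
  then have "|\<Union>i\<in>I. A i| \<le>o |I|"
    using assms(3)
    by (intro card_of_UNION_ordLeq_infinite)
      (auto simp: card_of_mono1 intro: ordLess_imp_ordLeq finite_set_ordLess_infinite_set)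
  then show ?thesis
    using assms(2) ordLeq_ordLess_trans by blast
qed

section \<open>Unions of blocks of a fast interval partition\<close>

text \<open>For strictly increasing \<open>e\<close> with \<open>e 0 = 0\<close> this is the index
  of the part \<open>{e j..<e (Suc j)}\<close> that contains \<open>k\<close>.\<close>

definition block :: "(nat \<Rightarrow> nat) \<Rightarrow> nat \<Rightarrow> nat" where
  "block e k = (GREATEST j. e j \<le> k)"

lemma block_bounds:
  assumes "strict_mono e" "e 0 = 0"
  shows "e (block e k) \<le> k" "k < e (Suc (block e k))"
proof -
  have b: "e j \<le> k \<Longrightarrow> j \<le> k" for j
    using strict_mono_imp_increasing[OF assms(1), of j] by simp
  show "e (block e k) \<le> k"
    unfolding block_def by (rule GreatestI_nat[of _ 0 k]) (use b assms(2) in auto)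
  show "k < e (Suc (block e k))"
  proof (rule ccontr)
    assume "\<not> k < e (Suc (block e k))"
    then have "Suc (block e k) \<le> block e k"
      unfolding block_def by (intro Greatest_le_nat[of _ _ k]) (use b in auto)
    then show False by simp
  qed
qed

lemma block_eqI:
  assumes "strict_mono e" "e 0 = 0" "e j \<le> k" "k < e (Suc j)"
  shows "block e k = j"
proof -
  have "e j < e (Suc (block e k))" "e (block e k) < e (Suc j)"
    using block_bounds[OF assms(1,2), of k] assms(3,4) by auto
  then show ?thesis
    by (simp add: assms(1) strict_mono_less)
qed

lemma mono_block:
  assumes "strict_mono e" "e 0 = 0" "k \<le> l"
  shows "block e k \<le> block e l"
proof -
  have "e (block e k) < e (Suc (block e l))"
    using block_bounds[OF assms(1,2)] assms(3) by (meson le_less_trans le_trans)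
  then show ?thesis
    by (simp add: assms(1) strict_mono_less)
qed

text \<open>
  Consecutive parts are merged in pairs; the shift \<open>s\<close>, 0 or 1, selects one of the two pairings, so
  that any two adjacent parts are merged by one of them.
\<close>

definition block_union :: "(nat \<Rightarrow> nat) \<Rightarrow> nat set \<Rightarrow> nat \<Rightarrow> nat set" where
  "block_union e r s = {k. (block e k + s) div 2 \<in> r}"

text \<open>If part \<open>i\<close> contains \<open>{m..<f m}\<close> and its merged index is in
  \<open>r\<close>, then that index is computed from \<open>m\<close> alone, because
  \<open>m < f m\<close> puts \<open>m\<close> itself into part \<open>i\<close>. Finitely many
  \<open>m\<close> would thus yield finitely many indices.\<close>

lemma infinite_gaps_block_union:
  assumes e: "strict_mono e" "e 0 = 0" and f: "\<And>m. m < f m"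
    and inf: "infinite ((\<lambda>i. (i + s) div 2) ` {i. \<exists>m. e i \<le> m \<and> f m \<le> e (Suc i)} \<inter> r)"
  shows "infinite {m. {m..<f m} \<subseteq> block_union e r s}"
proof
  assume fin: "finite {m. {m..<f m} \<subseteq> block_union e r s}"
  have "(i + s) div 2 \<in> (\<lambda>m. (block e m + s) div 2) ` {m. {m..<f m} \<subseteq> block_union e r s}"
    if m: "e i \<le> m" "f m \<le> e (Suc i)" and i: "(i + s) div 2 \<in> r" for i m
  proof -
    have bl: "block e k = i" if "k \<in> {m..<f m}" for k
      using that m by (intro block_eqI[OF e]) auto
    have "{m..<f m} \<subseteq> block_union e r s"
      using bl i by (auto simp: block_union_def)
    moreover have "block e m = i"
      using f by (intro bl) simp
    ultimately show ?thesis
      by blast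
  qed
  then have "(\<lambda>i. (i + s) div 2) ` {i. \<exists>m. e i \<le> m \<and> f m \<le> e (Suc i)} \<inter> r
      \<subseteq> (\<lambda>m. (block e m + s) div 2) ` {m. {m..<f m} \<subseteq> block_union e r s}"
    by auto
  then show False
    using inf fin by (meson finite_imageI finite_subset)
qed

text \<open>An interval \<open>{m..<f m}\<close> may straddle an endpoint of the partition. Escaping
  the second iterate of \<open>f\<close> rather than \<open>f\<close> leaves room for a whole
  interval on one of the two sides.\<close>

lemma ex_fast_partition:
  fixes F :: "(nat \<Rightarrow> nat) set"
  assumes F: "|F| <o cardinal_d" "\<And>f. f \<in> F \<Longrightarrow> mono f"
  obtains e where "strict_mono e" "e 0 = 0" "\<And>j. h (e j) < e (Suc j)"
    "\<And>f. f \<in> F \<Longrightarrow> infinite {i. \<exists>m. e i \<le> m \<and> f m \<le> e (Suc i)}"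
proof -
  obtain g where g: "\<And>f. f \<in> F \<Longrightarrow> infinite {n. f (f n) < g n}"
    using small_family_not_dominating[OF F(1), of "\<lambda>f n. f (f n)"] by blast
  obtain u where u: "strict_mono u" "\<And>n. g n + h n < u n" "\<And>n. n < u n"
    using strict_mono_majorant[of "\<lambda>n. g n + h n"] by blast
  \<comment> \<open>With the orbit of 0 under \<open>u\<close>, a point \<open>n\<close> of part
    \<open>j\<close> satisfies \<open>u n < e (Suc (Suc j))\<close>.\<close>
  define e where "e j = (u ^^ j) 0" for j
  have e0: "e 0 = 0" and eS: "e (Suc j) = u (e j)" for j
    by (simp_all add: e_def)
  have e: "strict_mono e"
    using u(3) by (simp add: strict_mono_Suc_iff eS)
  have "infinite {i. \<exists>m. e i \<le> m \<and> f m \<le> e (Suc i)}" if f: "f \<in> F" for f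
    unfolding infinite_nat_iff_unbounded_le
  proof
    fix N
    obtain n where n: "e N \<le> n" "f (f n) < g n"
      using g[OF f] unfolding infinite_nat_iff_unbounded_le by blast
    define j where "j = block e n"
    have j: "e j \<le> n" "n < e (Suc j)"
      using block_bounds[OF e e0] by (auto simp: j_def)
    have "e N < e (Suc j)"
      using n(1) j(2) by simp
    then have N: "N \<le> j"
      by (simp add: e strict_mono_less)
    have "f (f n) < e (Suc (Suc j))"
    proof -
      have "u n < u (e (Suc j))"
        using j(2) by (simp add: u(1) strict_mono_less)
      then show ?thesis
        using n(2) u(2)[of n] by (simp add: eS)
    qed
    \<comment> \<open>Either \<open>{n..<f n}\<close> stays in part \<open>j\<close>, or
      \<open>f n\<close> passes \<open>e (Suc j)\<close>; then monotonicity bounds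
      \<open>f (e (Suc j))\<close> by \<open>f (f n)\<close>, and part \<open>Suc j\<close> contains
      the interval starting at its own left end.\<close>
    show "\<exists>i\<ge>N. i \<in> {i. \<exists>m. e i \<le> m \<and> f m \<le> e (Suc i)}"
    proof (cases "f n \<le> e (Suc j)")
      case True
      then show ?thesis
        using N j(1) by blast
    next
      case False
      then have "f (e (Suc j)) \<le> f (f n)"
        using F(2)[OF f] by (simp add: monoD)
      then have "f (e (Suc j)) \<le> e (Suc (Suc j))"
        using \<open>f (f n) < e (Suc (Suc j))\<close> by simp
      then show ?thesis
        using N by (intro exI[of _ "Suc j"]) auto
    qed
  qed
  moreover have "h (e j) < e (Suc j)" for j
    using u(2)[of "e j"] by (simp add: eS)
  ultimately show ?thesis
    using that e e0 by blast
qed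

text \<open>One set \<open>r\<close> reaps the merged indices of the parts containing an interval of
  \<open>f\<close>, for all \<open>f\<close> at once. Replacing \<open>r\<close> by its complement
  complements the block union, so both halves of the reaping are used.\<close>

lemma ex_splitting_block_union:
  assumes F: "|F| <o cardinal_r" "\<And>f m. f \<in> F \<Longrightarrow> m < f m"
    and e: "strict_mono e" "e 0 = 0"
    and inf: "\<And>f. f \<in> F \<Longrightarrow> infinite {i. \<exists>m. e i \<le> m \<and> f m \<le> e (Suc i)}"
  shows "\<exists>r. \<forall>f\<in>F. infinite {m. {m..<f m} \<subseteq> block_union e r s} \<and>
    infinite {m. {m..<f m} \<subseteq> - block_union e r s}"
proof -
  define A where "A f = (\<lambda>i. (i + s) div 2) ` {i. \<exists>m. e i \<le> m \<and> f m \<le> e (Suc i)}" for f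
  have "infinite (A f)" if "f \<in> F" for f
  proof
    assume "finite (A f)"
    \<comment> \<open>Only indices up to \<open>2 * j + 1\<close> can have merged index
      \<open>j\<close>.\<close>
    then have "finite (\<Union>j\<in>A f. {..2 * j + 1})"
      by simp
    moreover have "{i. \<exists>m. e i \<le> m \<and> f m \<le> e (Suc i)} \<subseteq> (\<Union>j\<in>A f. {..2 * j + 1})"
    proof
      fix i assume "i \<in> {i. \<exists>m. e i \<le> m \<and> f m \<le> e (Suc i)}"
      then have "(i + s) div 2 \<in> A f"
        by (auto simp: A_def)
      moreover have "i \<le> 2 * ((i + s) div 2) + 1"
        by linarith
      ultimately show "i \<in> (\<Union>j\<in>A f. {..2 * j + 1})"
        by blast
    qed
    ultimately show False
      using inf[OF that] finite_subset by blast
  qed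
  then obtain r where r: "\<And>f. f \<in> F \<Longrightarrow> infinite (A f \<inter> r)" "\<And>f. f \<in> F \<Longrightarrow> infinite (A f - r)"
    using small_family_reaped[OF F(1), of A] by blast
  have compl: "- block_union e r s = block_union e (- r) s"
    by (auto simp: block_union_def)
  show ?thesis
  proof (intro exI[of _ r] ballI conjI)
    fix f assume f: "f \<in> F"
    show "infinite {m. {m..<f m} \<subseteq> block_union e r s}"
      using r(1)[OF f] F(2)[OF f] by (intro infinite_gaps_block_union e) (auto simp: A_def)
    show "infinite {m. {m..<f m} \<subseteq> - block_union e r s}"
      unfolding compl using r(2)[OF f] F(2)[OF f]
      by (intro infinite_gaps_block_union e) (auto simp: A_def Diff_eq)
  qed
qed

lemma block_union_homogeneous:
  assumes e: "strict_mono e" "e 0 = 0"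
    and le: "\<And>k. k \<in> {n..m} \<Longrightarrow> (block e k + s) div 2 = v"
  shows "{n..m} \<subseteq> block_union e r s \<or> {n..m} \<subseteq> - block_union e r s"
  using le by (cases "v \<in> r") (auto simp: block_union_def)

text \<open>The partition outgrows \<open>h\<close>, so \<open>{n..h n}\<close> meets at most two
  parts, which are adjacent, and one of the shifts merges them.\<close>

lemma block_union_covers_intervals:
  assumes e: "strict_mono e" "e 0 = 0" and h: "mono h" "\<And>j. h (e j) < e (Suc j)"
  shows "\<exists>s\<in>{0, 1}. {n..h n} \<subseteq> block_union e (r s) s \<or> {n..h n} \<subseteq> - block_union e (r s) s"
proof
  let ?j = "block e n"
  \<comment> \<open>This makes \<open>?j + ?s\<close> even, so parts \<open>?j\<close> and
    \<open>Suc ?j\<close> form a pair.\<close>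
  let ?s = "?j mod 2"
  show "?s \<in> {0, 1}"
    by auto
  have "(block e k + ?s) div 2 = (?j + ?s) div 2" if k: "k \<in> {n..h n}" for k
  proof -
    have "h n \<le> h (e (Suc ?j))"
      using block_bounds(2)[OF e, of n] h(1) by (simp add: monoD)
    then have "e (block e k) < e (Suc (Suc ?j))"
      using block_bounds(1)[OF e, of k] h(2)[of "Suc ?j"] k by simp
    then have "block e k \<le> Suc ?j"
      by (simp add: e(1) strict_mono_less)
    moreover have "?j \<le> block e k"
      using k by (simp add: mono_block[OF e])
    ultimately have "block e k = ?j \<or> block e k = Suc ?j"
      by linarith
    moreover have "(Suc ?j + ?s) div 2 = (?j + ?s) div 2"
      by presburger
    ultimately show ?thesis
      by auto
  qed
  then show "{n..h n} \<subseteq> block_union e (r ?s) ?s \<or> {n..h n} \<subseteq> - block_union e (r ?s) ?s"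
    by (rule block_union_homogeneous[OF e])
qed

text \<open>An interval inside neither the set nor its complement ends in a later pair than it
  starts in. One such change may only lead to the adjacent part; two in a row advance by at least
  two parts, and hence past \<open>h n\<close>.\<close>

lemma block_union_two_alternations:
  assumes e: "strict_mono e" "e 0 = 0" and h: "mono h" "\<And>j. h (e j) < e (Suc j)"
    and nm: "\<not> {n..m} \<subseteq> block_union e r 0" "\<not> {n..m} \<subseteq> - block_union e r 0"
    and mk: "\<not> {m..k} \<subseteq> block_union e r 0" "\<not> {m..k} \<subseteq> - block_union e r 0"
  shows "h n < k"
proof -
  have less: "block e a div 2 < block e b div 2"
    if ab: "\<not> {a..b} \<subseteq> block_union e r 0" "\<not> {a..b} \<subseteq> - block_union e r 0" for a b
  proof (rule ccontr)
    assume not: "\<not> block e a div 2 < block e b div 2"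
    have "block e a div 2 = block e k div 2" if "k \<in> {a..b}" for k
      using mono_block[OF e, of a k] mono_block[OF e, of k b] that not
      by (meson atLeastAtMost_iff div_le_mono le_antisym le_trans not_le)
    then show False
      using block_union_homogeneous[OF e, of a b 0 "block e a div 2" r] ab by simp
  qed
  have "Suc (Suc (block e n)) \<le> block e k"
    using less[OF nm] less[OF mk] by linarith
  moreover have "h n \<le> h (e (Suc (block e n)))"
    using block_bounds(2)[OF e, of n] h(1) by (simp add: monoD)
  ultimately have "h n < e (block e k)"
    using h(2)[of "Suc (block e n)"] e(1)
    by (meson le_less_trans less_le_trans strict_mono_less_eq)
  then show ?thesis
    using block_bounds(1)[OF e, of k] by simp
qed

text \<open>A single stage of the construction: for each of the two shifts, a block union with its
  own reaping set, together with its complement. The last clause is witnessed by shift 0.\<close>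

lemma ex_finite_splitting_family:
  fixes F :: "(nat \<Rightarrow> nat) set"
  assumes dr: "cardinal_d \<le>o cardinal_r"
    and F: "|F| <o cardinal_d" "\<And>f. f \<in> F \<Longrightarrow> mono f" "\<And>f m. f \<in> F \<Longrightarrow> m < f m"
    and h: "mono h"
  shows "\<exists>P. finite P \<and> (\<forall>x\<in>P. - x \<in> P) \<and> (\<forall>x\<in>P. \<forall>f\<in>F. infinite {m. {m..<f m} \<subseteq> x}) \<and>
    (\<forall>n. \<exists>x\<in>P. {n..h n} \<subseteq> x) \<and>
    (\<exists>x\<in>P. \<forall>n m k. \<not> {n..m} \<subseteq> x \<longrightarrow> \<not> {n..m} \<subseteq> - x \<longrightarrow> \<not> {m..k} \<subseteq> x \<longrightarrow> \<not> {m..k} \<subseteq> - x \<longrightarrow> h n < k)"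
proof -
  obtain e where e: "strict_mono e" "e 0 = 0" and he: "\<And>j. h (e j) < e (Suc j)"
    and inf: "\<And>f. f \<in> F \<Longrightarrow> infinite {i. \<exists>m. e i \<le> m \<and> f m \<le> e (Suc i)}"
    by (rule ex_fast_partition[OF F(1,2), of h]) auto
  have Fr: "|F| <o cardinal_r"
    using F(1) dr by (rule ordLess_ordLeq_trans)
  have "\<exists>r. \<forall>f\<in>F. infinite {m. {m..<f m} \<subseteq> block_union e r s} \<and>
      infinite {m. {m..<f m} \<subseteq> - block_union e r s}" for s
    using F(3) inf by (rule ex_splitting_block_union[OF Fr _ e])
  then obtain r where r: "\<And>s f. f \<in> F \<Longrightarrow> infinite {m. {m..<f m} \<subseteq> block_union e (r s) s}"
      "\<And>s f. f \<in> F \<Longrightarrow> infinite {m. {m..<f m} \<subseteq> - block_union e (r s) s}"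
    by metis
  let ?P = "\<Union>s\<in>{0, 1}. {block_union e (r s) s, - block_union e (r s) s}"
  show ?thesis
  proof (intro exI[of _ ?P] conjI)
    show "\<forall>x\<in>?P. \<forall>f\<in>F. infinite {m. {m..<f m} \<subseteq> x}"
      using r by auto
    show "\<forall>n. \<exists>x\<in>?P. {n..h n} \<subseteq> x"
      using block_union_covers_intervals[OF e h he, of _ r] by simp metis
    show "\<exists>x\<in>?P. \<forall>n m k. \<not> {n..m} \<subseteq> x \<longrightarrow> \<not> {n..m} \<subseteq> - x \<longrightarrow> \<not> {m..k} \<subseteq> x \<longrightarrow> \<not> {m..k} \<subseteq> - x \<longrightarrow> h n < k"
      using block_union_two_alternations[OF e h he, of _ _ "r 0"]
      by (intro bexI[of _ "block_union e (r 0) 0"]) auto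
  qed auto
qed

section \<open>The concentrated family\<close>

lemma ex_concentrated_family:
  assumes dr: "cardinal_d \<le>o cardinal_r"
  obtains X :: "nat set set" where
    "\<And>x. x \<in> X \<Longrightarrow> - x \<in> X" "\<And>x. x \<in> X \<Longrightarrow> infinite x"
    "\<And>f. |{x \<in> X. \<forall>m. x \<inter> {m..<f m} \<noteq> {}}| <o cardinal_d"
    "\<And>g. \<exists>K\<subseteq>X. finite K \<and> (\<forall>n. \<exists>x\<in>K. {n..g n} \<subseteq> x)"
    "\<And>g. \<exists>x\<in>X. \<forall>n m k. \<not> {n..m} \<subseteq> x \<longrightarrow> \<not> {n..m} \<subseteq> - x \<longrightarrow> \<not> {m..k} \<subseteq> x \<longrightarrow> \<not> {m..k} \<subseteq> - x \<longrightarrow> g n < k"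
proof -
  obtain D :: "(nat \<Rightarrow> nat) set" where D: "\<And>f. \<exists>h\<in>D. \<forall>n. f n \<le> h n" "\<And>h. h \<in> D \<Longrightarrow> mono h"
      "\<And>h n. h \<in> D \<Longrightarrow> n < h n" "|D| \<le>o cardinal_d" "infinite D"
    using everywhere_dominating_family by metis
  \<comment> \<open>Stage \<open>h\<close> handles its predecessors in the cardinal order
    \<open>|D|\<close>, fewer than \<open>|D|\<close> many, and \<open>h\<close> itself; the latter
    makes all members infinite, those of the first stage included.\<close>
  define I where "I h = insert h (underS |D| h)" for h
  have I_small: "|I h| <o |D|" if "h \<in> D" for h
  proof -
    have "|underS |D| h| <o |D|"
      using that by (intro card_of_underS) (auto simp: card_of_card_order_on Field_card_of)
    then show ?thesis
      using card_of_Un_ordLess_infinite[of D "{h}" "underS |D| h"] D(5)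
      by (simp add: I_def finite_set_ordLess_infinite_set)
  qed
  have I_sub: "I h \<subseteq> D" if "h \<in> D" for h
    using that underS_Field[of _ "|D|" h] by (auto simp: I_def Field_card_of)
  have "\<forall>h\<in>D. \<exists>P. finite P \<and> (\<forall>x\<in>P. - x \<in> P) \<and> (\<forall>x\<in>P. \<forall>f\<in>I h. infinite {m. {m..<f m} \<subseteq> x}) \<and>
    (\<forall>n. \<exists>x\<in>P. {n..h n} \<subseteq> x) \<and>
    (\<exists>x\<in>P. \<forall>n m k. \<not> {n..m} \<subseteq> x \<longrightarrow> \<not> {n..m} \<subseteq> - x \<longrightarrow> \<not> {m..k} \<subseteq> x \<longrightarrow> \<not> {m..k} \<subseteq> - x \<longrightarrow> h n < k)"
    (is "\<forall>h\<in>D. \<exists>P. ?R h P")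
  proof
    fix h assume h: "h \<in> D"
    have "|I h| <o cardinal_d"
      using I_small[OF h] D(4) by (rule ordLess_ordLeq_trans)
    then show "\<exists>P. ?R h P"
      using I_sub[OF h] D(2,3) h by (intro ex_finite_splitting_family[OF dr]) auto
  qed
  then obtain P where P: "\<forall>h\<in>D. ?R h (P h)"
    by (rule bchoice[THEN exE])
  then have fin: "\<And>h. h \<in> D \<Longrightarrow> finite (P h)"
    and compl: "\<And>h x. h \<in> D \<Longrightarrow> x \<in> P h \<Longrightarrow> - x \<in> P h"
    and inf: "\<And>h x f. h \<in> D \<Longrightarrow> x \<in> P h \<Longrightarrow> f \<in> I h \<Longrightarrow> infinite {m. {m..<f m} \<subseteq> x}"
    and cov: "\<And>h n. h \<in> D \<Longrightarrow> \<exists>x\<in>P h. {n..h n} \<subseteq> x"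
    by simp_all
  have alt: "\<exists>x\<in>P h. \<forall>n m k. \<not> {n..m} \<subseteq> x \<longrightarrow> \<not> {n..m} \<subseteq> - x \<longrightarrow> \<not> {m..k} \<subseteq> x \<longrightarrow> \<not> {m..k} \<subseteq> - x \<longrightarrow> h n < k"
    if "h \<in> D" for h
    using P[THEN bspec, OF that] by (elim conjE)
  define X where "X = (\<Union>h\<in>D. P h)"
  show ?thesis
  proof
    show "- x \<in> X" if "x \<in> X" for x
      using that compl by (auto simp: X_def)
    show "infinite x" if x: "x \<in> X" for x
    proof -
      obtain h where h: "h \<in> D" "x \<in> P h"
        using x by (auto simp: X_def)
      have "{m. {m..<h m} \<subseteq> x} \<subseteq> x"
        using D(3)[OF h(1)] by force
      then show ?thesis
        using inf[OF h, of h] finite_subset by (auto simp: I_def)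
    qed
    show "|{x \<in> X. \<forall>m. x \<inter> {m..<f m} \<noteq> {}}| <o cardinal_d" for f
    proof -
      obtain h where h: "h \<in> D" "\<And>n. f n \<le> h n"
        using D(1) by blast
      \<comment> \<open>A set meeting every \<open>{m..<f m}\<close> cannot come from a stage after
        \<open>h\<close>: there its complement contains some \<open>{m..<h m}\<close>.\<close>
      have "x \<in> (\<Union>h'\<in>I h. P h')" if x: "x \<in> X" "\<forall>m. x \<inter> {m..<f m} \<noteq> {}" for x
      proof -
        obtain h' where h': "h' \<in> D" "x \<in> P h'"
          using x(1) by (auto simp: X_def)
        have "h' \<in> I h"
        proof (rule ccontr)
          assume "h' \<notin> I h"
          then have "h \<in> I h'"
            using card_of_Well_order[of D] h(1) h'(1)
            by (auto simp: I_def underS_def order_on_defs total_on_def Field_card_of)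
          then have "infinite {m. {m..<h m} \<subseteq> - x}"
            using inf[OF h'(1) compl[OF h']] by blast
          then obtain m where "{m..<h m} \<subseteq> - x"
            using infinite_imp_nonempty by blast
          then have "x \<inter> {m..<f m} = {}"
            using h(2)[of m] by fastforce
          then show False
            using x(2) by blast
        qed
        then show ?thesis
          using h'(2) by blast
      qed
      then have "|{x \<in> X. \<forall>m. x \<inter> {m..<f m} \<noteq> {}}| \<le>o |\<Union>h'\<in>I h. P h'|"
        by (intro card_of_mono1) blast
      also have "|\<Union>h'\<in>I h. P h'| <o |D|"
        using I_small[OF h(1)] I_sub[OF h(1)] fin D(5) by (intro card_of_UN_finite_ordLess) auto
      finally show ?thesis
        using D(4) ordLess_ordLeq_trans by blast
    qed
    show "\<exists>K\<subseteq>X. finite K \<and> (\<forall>n. \<exists>x\<in>K. {n..g n} \<subseteq> x)" for g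
    proof -
      obtain h where h: "h \<in> D" "\<And>n. g n \<le> h n"
        using D(1) by blast
      have "\<exists>x\<in>P h. {n..g n} \<subseteq> x" for n
        using cov[OF h(1), of n] h(2)[of n] by (meson atLeastatMost_subset_iff order_refl subset_trans)
      then show ?thesis
        using h(1) fin by (intro exI[of _ "P h"]) (auto simp: X_def)
    qed
    show "\<exists>x\<in>X. \<forall>n m k. \<not> {n..m} \<subseteq> x \<longrightarrow> \<not> {n..m} \<subseteq> - x \<longrightarrow> \<not> {m..k} \<subseteq> x \<longrightarrow> \<not> {m..k} \<subseteq> - x \<longrightarrow> g n < k" for g
    proof -
      obtain h where h: "h \<in> D" "\<And>n. g n \<le> h n"
        using D(1) by blast
      show ?thesis
        using alt[OF h(1)] h unfolding X_def by (meson UN_I le_less_trans)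
    qed
  qed
qed

section \<open>Subsets of the Cantor set\<close>

text \<open>Base 3 with digits 0 and 1: the image of the power set is the Cantor ternary set scaled
  by 3/2. The gaps make the coding a homeomorphic embedding, which base 2 would not give.\<close>

definition cantor_code :: "nat set \<Rightarrow> real" where
  "cantor_code a = (\<Sum>k. indicator a k * (1/3) ^ k)"

lemma summable_cantor_code: "summable (\<lambda>k. indicator a k * (1/3 :: real) ^ k)"
  by (rule summable_comparison_test'[of "\<lambda>k. (1/3) ^ k" 0]) (auto simp: indicator_def)

lemma cantor_code_prefix:
  shows "(\<Sum>k<n. indicator a k * (1/3) ^ k) \<le> cantor_code a"
    and "cantor_code a \<le> (\<Sum>k<n. indicator a k * (1/3) ^ k) + 3/2 * (1/3) ^ n"
proof -
  have eq: "cantor_code a = (\<Sum>k. indicator a (k + n) * (1/3) ^ (k + n)) + (\<Sum>k<n. indicator a k * (1/3) ^ k)"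
    unfolding cantor_code_def by (rule suminf_split_initial_segment[OF summable_cantor_code])
  have sm: "summable (\<lambda>k. indicator a (k + n) * (1/3 :: real) ^ (k + n))"
    using summable_cantor_code by (rule summable_ignore_initial_segment)
  have geo: "(\<lambda>k. (1/3 :: real) ^ (k + n)) sums (3/2 * (1/3) ^ n)"
    using sums_mult2[OF geometric_sums[of "1/3 :: real"], of "(1/3) ^ n"] by (simp add: power_add)
  have "0 \<le> (\<Sum>k. indicator a (k + n) * (1/3 :: real) ^ (k + n))"
    by (intro suminf_nonneg sm) simp
  then show "(\<Sum>k<n. indicator a k * (1/3) ^ k) \<le> cantor_code a"
    using eq by linarith
  have "(\<Sum>k. indicator a (k + n) * (1/3 :: real) ^ (k + n)) \<le> (\<Sum>k. (1/3) ^ (k + n))"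
    using geo by (intro suminf_le sm) (auto simp: indicator_def sums_iff)
  then show "cantor_code a \<le> (\<Sum>k<n. indicator a k * (1/3) ^ k) + 3/2 * (1/3) ^ n"
    using eq geo by (simp add: sums_iff)
qed

lemma cantor_code_close:
  assumes "a \<inter> {..<n} = b \<inter> {..<n}"
  shows "\<bar>cantor_code a - cantor_code b\<bar> \<le> 3/2 * (1/3) ^ n"
proof -
  have "(\<Sum>k<n. indicator a k * (1/3 :: real) ^ k) = (\<Sum>k<n. indicator b k * (1/3) ^ k)"
    using assms by (intro sum.cong) (auto simp: indicator_def)
  then show ?thesis
    using cantor_code_prefix[where n=n and a=a] cantor_code_prefix[where n=n and a=b] by linarith
qed

text \<open>At the first difference \<open>n\<close> the sums differ by \<open>(1/3) ^ n\<close>,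
  and the tails beyond it can cancel at most half of that.\<close>

lemma cantor_code_separated:
  assumes "(k \<in> a) \<noteq> (k \<in> b)"
  shows "1/2 * (1/3) ^ k \<le> \<bar>cantor_code a - cantor_code b\<bar>"
proof -
  define n where "n = (LEAST k. (k \<in> a) \<noteq> (k \<in> b))"
  have n: "(n \<in> a) \<noteq> (n \<in> b)" "n \<le> k" and less: "\<And>i. i < n \<Longrightarrow> i \<in> a \<longleftrightarrow> i \<in> b"
    using LeastI[of "\<lambda>k. (k \<in> a) \<noteq> (k \<in> b)"] Least_le[of "\<lambda>k. (k \<in> a) \<noteq> (k \<in> b)"]
      not_less_Least[of _ "\<lambda>k. (k \<in> a) \<noteq> (k \<in> b)"] assms unfolding n_def by blast+
  have "(\<Sum>k<n. indicator a k * (1/3 :: real) ^ k) = (\<Sum>k<n. indicator b k * (1/3) ^ k)"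
    using less by (intro sum.cong) (auto simp: indicator_def)
  then have "1/2 * (1/3) ^ n \<le> \<bar>cantor_code a - cantor_code b\<bar>"
    using cantor_code_prefix[where n="Suc n" and a=a] cantor_code_prefix[where n="Suc n" and a=b] n(1)
    by (auto simp: indicator_def)
  moreover have "(1/3 :: real) ^ k \<le> (1/3) ^ n"
    using n(2) by (simp add: power_decreasing)
  ultimately show ?thesis
    by linarith
qed

lemma inj_cantor_code: "inj cantor_code"
proof (rule injI)
  fix a b assume eq: "cantor_code a = cantor_code b"
  have "k \<in> a \<longleftrightarrow> k \<in> b" for k
  proof (rule ccontr)
    assume "(k \<in> a) \<noteq> (k \<in> b)"
    from cantor_code_separated[OF this] eq have "(1/3 :: real) ^ k \<le> 0"
      by simp
    then show False
      using zero_less_power[of "1/3 :: real" k] by linarith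
  qed
  then show "a = b"
    by blast
qed

text \<open>Balls of radius \<open>1/2 * (1/3) ^ N\<close> around codes contain only codes of sets
  that agree with the centre below \<open>N\<close>.\<close>

lemma openin_cantor_code_determined:
  assumes "\<And>a b. a \<inter> {..<N} = b \<inter> {..<N} \<Longrightarrow> Q a \<longleftrightarrow> Q b"
  shows "openin (top_of_set (cantor_code ` Y)) (cantor_code ` {a \<in> Y. Q a})"
proof -
  have "cantor_code ` {a \<in> Y. Q a} =
      cantor_code ` Y \<inter> (\<Union>a\<in>{a. Q a}. ball (cantor_code a) (1/2 * (1/3) ^ N))"
  proof (intro set_eqI iffI)
    fix r assume "r \<in> cantor_code ` Y \<inter> (\<Union>a\<in>{a. Q a}. ball (cantor_code a) (1/2 * (1/3) ^ N))"
    then obtain a b where ab: "r = cantor_code b" "b \<in> Y" "Q a"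
      "\<bar>cantor_code a - cantor_code b\<bar> < 1/2 * (1/3) ^ N"
      by (auto simp: dist_real_def)
    have "k \<in> a \<longleftrightarrow> k \<in> b" if "k < N" for k
    proof (rule ccontr)
      assume "(k \<in> a) \<noteq> (k \<in> b)"
      from cantor_code_separated[OF this] ab(4) have "(1/3 :: real) ^ k < (1/3) ^ N"
        by linarith
      then show False
        using that by (simp add: power_strict_decreasing_iff)
    qed
    then have "a \<inter> {..<N} = b \<inter> {..<N}"
      by auto
    then show "r \<in> cantor_code ` {a \<in> Y. Q a}"
      using assms ab by blast
  qed auto
  then show ?thesis
    by (simp only:) (intro openin_open_Int open_UN ballI open_ball)
qed

lemma openin_prod_cantor_code_determined:
  assumes "\<And>a b a' b'. a \<inter> {..<N} = a' \<inter> {..<N} \<Longrightarrow> b \<inter> {..<N} = b' \<inter> {..<N} \<Longrightarrow> Q a b \<Longrightarrow> Q a' b'"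
  shows "openin (prod_topology (top_of_set (cantor_code ` Y)) (top_of_set (cantor_code ` Y)))
    {(cantor_code a, cantor_code b) |a b. a \<in> Y \<and> b \<in> Y \<and> Q a b}"
proof -
  let ?T = "top_of_set (cantor_code ` Y)"
  \<comment> \<open>Cylinders relative to \<open>Y\<close>; the set in question is a union of
    rectangles of cylinders.\<close>
  define C where "C a = cantor_code ` {a' \<in> Y. a' \<inter> {..<N} = a \<inter> {..<N}}" for a
  have C: "openin ?T (C a)" for a
    unfolding C_def by (rule openin_cantor_code_determined[of N]) auto
  have "{(cantor_code a, cantor_code b) |a b. a \<in> Y \<and> b \<in> Y \<and> Q a b} =
      (\<Union>(a, b)\<in>{(a, b). Q a b}. C a \<times> C b)"
    (is "?L = ?R")
  proof (intro set_eqI iffI)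
    fix p assume "p \<in> ?L"
    then show "p \<in> ?R"
      by (auto simp: C_def)
  next
    fix p assume "p \<in> ?R"
    then obtain a b where Q: "Q a b" and p: "fst p \<in> C a" "snd p \<in> C b"
      by auto
    obtain a' b' where ab: "a' \<in> Y" "b' \<in> Y" "a' \<inter> {..<N} = a \<inter> {..<N}" "b' \<inter> {..<N} = b \<inter> {..<N}"
        "p = (cantor_code a', cantor_code b')"
      using p by (auto simp: C_def prod_eq_iff)
    have "Q a' b'"
      using assms[OF _ _ Q] ab(3,4) by simp
    then show "p \<in> ?L"
      using ab by blast
  qed
  moreover have "openin (prod_topology ?T ?T) (\<Union>(a, b)\<in>{(a, b). Q a b}. C a \<times> C b)"
  proof (rule openin_Union)
    fix K assume "K \<in> (\<lambda>(a, b). C a \<times> C b) ` {(a, b). Q a b}"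
    then obtain a b where K: "K = C a \<times> C b"
      by auto
    show "openin (prod_topology ?T ?T) K"
      unfolding K openin_prod_Times_iff using C by blast
  qed
  ultimately show ?thesis
    by simp
qed

section \<open>The Menger property of the concentrated set\<close>

lemma ex_countable_subcover_real:
  fixes S :: "real set"
  assumes "open_cover (top_of_set S) \<U>"
  obtains \<V> where "countable \<V>" "\<V> \<subseteq> \<U>" "S \<subseteq> \<Union>\<V>"
proof -
  have "\<And>U. U \<in> \<U> \<Longrightarrow> openin (top_of_set S) U" "\<Union>\<U> = S"
    using assms by (auto simp: open_cover_def)
  then show ?thesis
    using Lindelof_openin[of \<U> S] that by (metis order_refl)
qed

text \<open>One member of each cover suffices to catch the countably many finite sets. The union of
  these members is open and misses fewer than \<open>cardinal_d\<close> points, and those are caught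
  by a function that their index functions do not dominate.\<close>

lemma Menger_space_concentrated:
  assumes conc: "\<And>f. |{x \<in> X. \<forall>m. x \<inter> {m..<f m} \<noteq> {}}| <o cardinal_d"
  shows "Menger_space (top_of_set (cantor_code ` (X \<union> Collect finite)))"
  unfolding Menger_space_def
proof (intro allI impI)
  let ?Y = "X \<union> Collect finite"
  let ?T = "top_of_set (cantor_code ` ?Y)"
  fix \<U> :: "nat \<Rightarrow> real set set"
  assume U: "\<forall>n. open_cover ?T (\<U> n)"
  have "\<exists>A\<in>\<U> n. cantor_code a \<in> A" if "a \<in> ?Y" for n a
    using U that unfolding open_cover_def by (metis Union_iff imageI topspace_euclidean_subtopology)
  then have "\<exists>A. \<forall>n. A n \<in> \<U> n \<and> cantor_code (from_nat_into (Collect finite) n) \<in> A n"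
    by (intro choice) (metis Un_iff finite.emptyI empty_iff from_nat_into mem_Collect_eq Bex_def)
  then obtain A where A: "\<And>n. A n \<in> \<U> n" "\<And>n. cantor_code (from_nat_into (Collect finite) n) \<in> A n"
    by blast
  have opn: "openin ?T (\<Union>n. A n)"
    using A(1) U by (intro openin_Union) (auto simp: open_cover_def)
  have finA: "cantor_code q \<in> (\<Union>n. A n)" if "finite q" for q
    using A(2) from_nat_into_surj[of "Collect finite" q] that
    by (metis UN_I UNIV_I countable_Collect_finite mem_Collect_eq)
  \<comment> \<open>The open set contains a neighbourhood of each finite \<open>q\<close>, and hence
    a cylinder around it.\<close>
  have "\<exists>N. \<forall>x\<in>?Y. x \<inter> {..<N} = q \<inter> {..<N} \<longrightarrow> cantor_code x \<in> (\<Union>n. A n)" if q: "finite q" for q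
  proof -
    obtain e where e: "0 < e" "\<And>y. y \<in> cantor_code ` ?Y \<Longrightarrow> dist y (cantor_code q) < e \<Longrightarrow> y \<in> (\<Union>n. A n)"
      using opn finA[OF q] unfolding openin_euclidean_subtopology_iff by metis
    obtain N where "(1/3 :: real) ^ N < 2/3 * e"
      using real_arch_pow_inv[of "2/3 * e" "1/3"] e(1) by auto
    then have "dist (cantor_code x) (cantor_code q) < e" if "x \<inter> {..<N} = q \<inter> {..<N}" for x
      using cantor_code_close[OF that] by (simp add: dist_real_def)
    then show ?thesis
      using e(2) by blast
  qed
  then obtain N where N: "\<And>q x. finite q \<Longrightarrow> x \<in> ?Y \<Longrightarrow> x \<inter> {..<N q} = q \<inter> {..<N q} \<Longrightarrow> cantor_code x \<in> (\<Union>n. A n)"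
    by metis
  \<comment> \<open>This bounds \<open>N q\<close> for all \<open>q\<close> below \<open>m\<close>,
    so a set missing \<open>{m..<f m}\<close> lies in the cylinder around its own part below
    \<open>m\<close>.\<close>
  define f where "f m = (\<Sum>q\<in>Pow {..<m}. N q)" for m
  define Z where "Z = {x \<in> X. \<forall>m. x \<inter> {m..<f m} \<noteq> {}}"
  have caught: "cantor_code x \<in> (\<Union>n. A n)" if x: "x \<in> ?Y" "x \<notin> Z" for x
  proof (cases "finite x")
    case False
    then obtain m where m: "x \<inter> {m..<f m} = {}"
      using x by (auto simp: Z_def)
    have "N (x \<inter> {..<m}) \<le> f m"
      unfolding f_def by (rule member_le_sum) auto
    then have "x \<inter> {..<N (x \<inter> {..<m})} = (x \<inter> {..<m}) \<inter> {..<N (x \<inter> {..<m})}"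
      using m by fastforce
    then show ?thesis
      using N[of "x \<inter> {..<m}" x] x(1) by simp
  qed (use finA in blast)
  have "\<exists>\<V>. countable \<V> \<and> \<V> \<subseteq> \<U> n \<and> cantor_code ` ?Y \<subseteq> \<Union>\<V>" for n
    using ex_countable_subcover_real U by metis
  then obtain \<V> where V: "\<And>n. countable (\<V> n)" "\<And>n. \<V> n \<subseteq> \<U> n" "\<And>n. cantor_code ` ?Y \<subseteq> \<Union>(\<V> n)"
    by metis
  have "\<exists>i. cantor_code x \<in> from_nat_into (\<V> n) i" if "x \<in> ?Y" for x n
    using V(1,3)[of n] that by (metis Union_iff from_nat_into_surj imageI subsetD)
  then obtain \<phi> where phi: "\<And>x n. x \<in> ?Y \<Longrightarrow> cantor_code x \<in> from_nat_into (\<V> n) (\<phi> x n)"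
    by metis
  obtain g where g: "\<And>x. x \<in> Z \<Longrightarrow> infinite {n. \<phi> x n < g n}"
    using small_family_not_dominating[of Z \<phi>] conc unfolding Z_def by blast
  have ne: "\<V> n \<noteq> {}" for n
    using V(3)[of n] by auto
  \<comment> \<open>\<open>A n\<close> serves the points outside \<open>Z\<close>, the first
    \<open>g n\<close> members of the countable subcover those in \<open>Z\<close>.\<close>
  let ?F = "\<lambda>n. insert (A n) (from_nat_into (\<V> n) ` {..<g n})"
  show "\<exists>\<F>. (\<forall>n. finite (\<F> n) \<and> \<F> n \<subseteq> \<U> n) \<and> topspace ?T \<subseteq> \<Union>(\<Union>n. \<F> n)"
  proof (intro exI[of _ ?F] conjI allI)
    show "?F n \<subseteq> \<U> n" for n
      using A(1) V(2)[of n] from_nat_into[OF ne[of n]] by auto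
    have "cantor_code x \<in> \<Union>(\<Union>n. ?F n)" if x: "x \<in> ?Y" for x
    proof (cases "x \<in> Z")
      case True
      then obtain n where "\<phi> x n < g n"
        using infinite_imp_nonempty[OF g] by blast
      then show ?thesis
        using phi[OF x, of n] by blast
    next
      case False
      then show ?thesis
        using caught[OF x] by blast
    qed
    then show "topspace ?T \<subseteq> \<Union>(\<Union>n. ?F n)"
      by auto
  qed simp
qed

section \<open>Failure of the Scheepers property and of the Menger property of the square\<close>

lemma finite_subset_range_chain:
  fixes C :: "nat \<Rightarrow> 'a set"
  assumes "finite \<F>" "\<F> \<subseteq> range C" "mono C"
  shows "\<exists>k. \<Union>\<F> \<subseteq> C k"
proof -
  obtain J where J: "finite J" "\<F> = C ` J"
    using finite_subset_image[OF assms(1,2)] by blast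
  \<comment> \<open>The sum of the indices is an upper bound that also makes sense for empty
    \<open>J\<close>.\<close>
  have "C j \<subseteq> C (\<Sum>J)" if "j \<in> J" for j
    using monoD[OF assms(3)] member_le_sum[of j J "\<lambda>i. i"] J(1) that by auto
  then show ?thesis
    using J(2) by blast
qed

text \<open>Cover \<open>n\<close> sorts the points by how far beyond \<open>n\<close> an omitted
  element must be sought. It increases with \<open>k\<close>, so a finite selection amounts to one
  bound \<open>g n\<close>, and the finite set \<open>K\<close> belonging to \<open>g\<close> has
  for each \<open>n\<close> a point that is not covered.\<close>

lemma not_Scheepers_space_cantor_code:
  assumes coinf: "\<And>x. x \<in> Y \<Longrightarrow> infinite (- x)"
    and cov: "\<And>g. \<exists>K\<subseteq>Y. finite K \<and> (\<forall>n. \<exists>x\<in>K. {n..g n} \<subseteq> x)"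
  shows "\<not> Scheepers_space (top_of_set (cantor_code ` Y))"
proof
  let ?T = "top_of_set (cantor_code ` Y)"
  assume S: "Scheepers_space ?T"
  define C where "C n k = cantor_code ` {a \<in> Y. \<not> {n..k} \<subseteq> a}" for n k
  have "open_cover ?T (range (C n))" for n
    unfolding open_cover_def
  proof (intro conjI ballI)
    show "openin ?T U" if U: "U \<in> range (C n)" for U
    proof -
      obtain k where "U = C n k"
        using U by blast
      moreover have "openin ?T (C n k)"
        unfolding C_def
      proof (rule openin_cantor_code_determined[of "Suc k"])
        fix a b assume "a \<inter> {..<Suc k} = b \<inter> {..<Suc k}"
        then have "j \<in> a \<longleftrightarrow> j \<in> b" if "j \<le> k" for j
          using that by (auto simp: set_eq_iff less_Suc_eq_le)
        then show "\<not> {n..k} \<subseteq> a \<longleftrightarrow> \<not> {n..k} \<subseteq> b"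
          by (auto simp: subset_iff)
      qed
      ultimately show ?thesis
        by simp
    qed
    have "\<exists>k. \<not> {n..k} \<subseteq> a" if a: "a \<in> Y" for a
    proof -
      obtain k where "n \<le> k" "k \<in> - a"
        using coinf[OF a] unfolding infinite_nat_iff_unbounded_le by blast
      then show ?thesis
        by (intro exI[of _ k]) auto
    qed
    then show "\<Union> (range (C n)) = topspace ?T"
      unfolding C_def topspace_euclidean_subtopology by blast
  qed
  then have "\<exists>\<F>. (\<forall>n. finite (\<F> n) \<and> \<F> n \<subseteq> range (C n)) \<and>
      (\<forall>K. finite K \<and> K \<subseteq> cantor_code ` Y \<longrightarrow> (\<exists>n. K \<subseteq> \<Union>(\<F> n)))"
    using S[unfolded Scheepers_space_def, THEN spec, of "\<lambda>n. range (C n)"] by simp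
  then obtain \<F> where F: "\<forall>n. finite (\<F> n) \<and> \<F> n \<subseteq> range (C n)"
      and covers: "\<forall>K. finite K \<and> K \<subseteq> cantor_code ` Y \<longrightarrow> (\<exists>n. K \<subseteq> \<Union>(\<F> n))"
    by (elim exE conjE) (rule that)
  have "mono (C n)" for n
    unfolding C_def mono_def by fastforce
  then have "\<exists>k. \<Union>(\<F> n) \<subseteq> C n k" for n
    using F by (simp add: finite_subset_range_chain)
  then obtain g where g: "\<And>n. \<Union>(\<F> n) \<subseteq> C n (g n)"
    by metis
  obtain K where K: "K \<subseteq> Y" "finite K" "\<And>n. \<exists>x\<in>K. {n..g n} \<subseteq> x"
    using cov[of g] by blast
  obtain n where n: "cantor_code ` K \<subseteq> \<Union>(\<F> n)"
    using covers[THEN spec, of "cantor_code ` K"] K(1,2) by (auto simp: image_mono)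
  obtain x where x: "x \<in> K" "{n..g n} \<subseteq> x"
    using K(3) by blast
  have "cantor_code x \<in> C n (g n)"
    using n g[of n] x(1) by blast
  then show False
    using x(2) injD[OF inj_cantor_code] by (auto simp: C_def)
qed

lemma not_Menger_space_cantor_code_square:
  assumes coinf: "\<And>x. x \<in> Y \<Longrightarrow> infinite (- x)"
    and X: "X \<subseteq> Y" "\<And>x. x \<in> X \<Longrightarrow> - x \<in> X"
    and alt: "\<And>g. \<exists>x\<in>X. \<forall>n m k. \<not> {n..m} \<subseteq> x \<longrightarrow> \<not> {n..m} \<subseteq> - x \<longrightarrow>
      \<not> {m..k} \<subseteq> x \<longrightarrow> \<not> {m..k} \<subseteq> - x \<longrightarrow> g n < k"
  shows "\<not> Menger_space (prod_topology (top_of_set (cantor_code ` Y)) (top_of_set (cantor_code ` Y)))"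
proof
  let ?T = "top_of_set (cantor_code ` Y)"
  assume M: "Menger_space (prod_topology ?T ?T)"
  \<comment> \<open>The bound \<open>m\<le>k\<close> makes the condition depend only on elements up
    to \<open>k\<close>, so that it defines an open set.\<close>
  define Q where "Q n k a b \<longleftrightarrow> (\<exists>m\<le>k. \<not> {n..m} \<subseteq> a \<and> \<not> {n..m} \<subseteq> b \<and> \<not> {m..k} \<subseteq> a \<and> \<not> {m..k} \<subseteq> b)"
    for n k :: nat and a b
  define C where "C n k = {(cantor_code a, cantor_code b) |a b. a \<in> Y \<and> b \<in> Y \<and> Q n k a b}" for n k
  have C_iff: "(cantor_code a, cantor_code b) \<in> C n k \<longleftrightarrow> a \<in> Y \<and> b \<in> Y \<and> Q n k a b" for a b n k
    by (auto simp: C_def inj_eq[OF inj_cantor_code])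
  have oc: "openin (prod_topology ?T ?T) (C n k)" for n k
    unfolding C_def
  proof (rule openin_prod_cantor_code_determined[of "Suc k"])
    have sub: "{i..j} \<subseteq> a \<longleftrightarrow> {i..j} \<subseteq> a'" if "a \<inter> {..<Suc k} = a' \<inter> {..<Suc k}" "j \<le> k" for a a' :: "nat set" and i j
    proof -
      have "l \<in> a \<longleftrightarrow> l \<in> a'" if "l \<le> k" for l
        using \<open>a \<inter> {..<Suc k} = a' \<inter> {..<Suc k}\<close> that by (auto simp: set_eq_iff less_Suc_eq_le)
      then show ?thesis
        using \<open>j \<le> k\<close> by (auto simp: subset_iff)
    qed
    fix a b a' b' :: "nat set"
    assume "a \<inter> {..<Suc k} = a' \<inter> {..<Suc k}" "b \<inter> {..<Suc k} = b' \<inter> {..<Suc k}" "Q n k a b"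
    then show "Q n k a' b'"
      unfolding Q_def using sub by (metis order_refl)
  qed
  have "open_cover (prod_topology ?T ?T) (range (C n))" for n
    unfolding open_cover_def
  proof (intro conjI ballI)
    show "openin (prod_topology ?T ?T) U" if "U \<in> range (C n)" for U
      using that oc by blast
    have ex: "\<exists>m. \<forall>k\<ge>m. \<not> {n..k} \<subseteq> a" if a: "a \<in> Y" for a n
    proof -
      obtain j where "n \<le> j" "j \<in> - a"
        using coinf[OF a] unfolding infinite_nat_iff_unbounded_le by blast
      then show ?thesis
        by (intro exI[of _ j]) auto
    qed
    have ex2: "\<exists>m. \<forall>k\<ge>m. \<not> {n..k} \<subseteq> a \<and> \<not> {n..k} \<subseteq> b" if "a \<in> Y" "b \<in> Y" for a b n
      using ex[OF that(1), of n] ex[OF that(2), of n] by (meson le_trans nle_le)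
    have "\<exists>k. Q n k a b" if ab: "a \<in> Y" "b \<in> Y" for a b
    proof -
      obtain m where m: "\<not> {n..m} \<subseteq> a" "\<not> {n..m} \<subseteq> b"
        using ex2[OF ab, of n] by blast
      obtain k where "\<And>k'. k \<le> k' \<Longrightarrow> \<not> {m..k'} \<subseteq> a \<and> \<not> {m..k'} \<subseteq> b"
        using ex2[OF ab, of m] by blast
      \<comment> \<open>The maximum ensures that the second interval does not end before
        \<open>m\<close>.\<close>
      then have "\<not> {m..max m k} \<subseteq> a" "\<not> {m..max m k} \<subseteq> b"
        by simp_all
      then show ?thesis
        unfolding Q_def using m by (intro exI[of _ "max m k"] exI[of _ m]) simp
    qed
    then show "\<Union> (range (C n)) = topspace (prod_topology ?T ?T)"
      unfolding C_def by fastforce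
  qed
  then have "\<exists>\<F>. (\<forall>n. finite (\<F> n) \<and> \<F> n \<subseteq> range (C n)) \<and>
      topspace (prod_topology ?T ?T) \<subseteq> \<Union>(\<Union>n. \<F> n)"
    using M[unfolded Menger_space_def, THEN spec, of "\<lambda>n. range (C n)"] by simp
  then obtain \<F> where F: "\<forall>n. finite (\<F> n) \<and> \<F> n \<subseteq> range (C n)"
      and covers: "topspace (prod_topology ?T ?T) \<subseteq> \<Union>(\<Union>n. \<F> n)"
    by (elim exE conjE) (rule that)
  have Q_mono: "Q n k' a b" if Q: "Q n k a b" and "k \<le> k'" for n k k' a b
  proof -
    have "{m..k} \<subseteq> {m..k'}" for m
      using that by auto
    then show ?thesis
      using Q \<open>k \<le> k'\<close> unfolding Q_def by (meson le_trans subset_trans)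
  qed
  have "mono (C n)" for n
    unfolding C_def mono_def using Q_mono by blast
  then have "\<exists>k. \<Union>(\<F> n) \<subseteq> C n k" for n
    using F by (simp add: finite_subset_range_chain)
  then obtain g where g: "\<And>n. \<Union>(\<F> n) \<subseteq> C n (g n)"
    by metis
  obtain x where x: "x \<in> X" and less: "\<forall>n m k. \<not> {n..m} \<subseteq> x \<longrightarrow> \<not> {n..m} \<subseteq> - x \<longrightarrow>
      \<not> {m..k} \<subseteq> x \<longrightarrow> \<not> {m..k} \<subseteq> - x \<longrightarrow> g n < k"
    by (rule bexE[OF alt])
  have "(cantor_code x, cantor_code (- x)) \<in> topspace (prod_topology ?T ?T)"
    using x X by auto
  then obtain n where "(cantor_code x, cantor_code (- x)) \<in> C n (g n)"
    using covers g by blast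
  \<comment> \<open>For the pair \<open>x\<close> and \<open>- x\<close>, lying in
    \<open>C n (g n)\<close> means two alternations that end at \<open>g n\<close>, whence
    \<open>g n < g n\<close>.\<close>
  then show False
    unfolding C_iff Q_def using less by (metis less_irrefl)
qed

theorem theorem2p1:
  assumes "cardinal_d \<le>o cardinal_r"
  shows "(\<exists>X :: real topology. set_of_reals X \<and> Menger_space X \<and> \<not> Scheepers_space X) \<and>
         (\<exists>(X :: real topology) (Y :: real topology). set_of_reals X \<and> Menger_space X \<and> set_of_reals Y \<and> Menger_space Y \<and>
                \<not> Menger_space (prod_topology X Y))"
proof -
  obtain X :: "nat set set" where compl: "\<And>x. x \<in> X \<Longrightarrow> - x \<in> X" and inf: "\<And>x. x \<in> X \<Longrightarrow> infinite x"
    and conc: "\<And>f. |{x \<in> X. \<forall>m. x \<inter> {m..<f m} \<noteq> {}}| <o cardinal_d"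
    and cov: "\<And>g. \<exists>K\<subseteq>X. finite K \<and> (\<forall>n. \<exists>x\<in>K. {n..g n} \<subseteq> x)"
    and alt: "\<And>g. \<exists>x\<in>X. \<forall>n m k. \<not> {n..m} \<subseteq> x \<longrightarrow> \<not> {n..m} \<subseteq> - x \<longrightarrow> \<not> {m..k} \<subseteq> x \<longrightarrow> \<not> {m..k} \<subseteq> - x \<longrightarrow> g n < k"
    by (rule ex_concentrated_family[OF assms]) (rule that)
  \<comment> \<open>This one set refutes the Scheepers property and serves as both factors of the
    product.\<close>
  let ?Y = "X \<union> Collect finite"
  let ?T = "top_of_set (cantor_code ` ?Y)"
  have coinf: "infinite (- x)" if "x \<in> ?Y" for x
    using that compl inf finite_compl[of x] infinite_UNIV_nat by auto
  have "set_of_reals ?T"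
    unfolding set_of_reals_def using homeomorphic_space_refl by blast
  moreover have "Menger_space ?T"
    using conc by (rule Menger_space_concentrated)
  moreover have "\<exists>K\<subseteq>?Y. finite K \<and> (\<forall>n. \<exists>x\<in>K. {n..g n} \<subseteq> x)" for g
    using cov[of g] by (meson le_supI1)
  then have "\<not> Scheepers_space ?T"
    using coinf by (intro not_Scheepers_space_cantor_code)
  moreover have "\<not> Menger_space (prod_topology ?T ?T)"
    using coinf Un_upper1 compl alt by (rule not_Menger_space_cantor_code_square)
  ultimately show ?thesis
    by blast
qed

end
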